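(* Let $d=2$, let $n\geq 3$ and $a\geq 1$ be integers, and for $m\in\mathbb{N}_0$ let $$F(m)=\sum_{s=0}^{n}(-1)^s\binom{n}{s}\binom{2+m-sa}{2},\qquad F^+(m)=\max\{0,F(m)\},$$ where $\binom{N}{K}$ is taken to be zero unless $N\geq K\geq 0$. Then the smallest zero $m_0 \in \mathbb{N}_0$ of $F^+(m)$ is $$m_0=3a-2\quad\text{if } n=3,$$ and $$m_0=\left\lceil \frac{1}{2(n-1)}\left(3-3n+2an+\sqrt{1-2n+n^2+4a^2n}\right)\right\rceil\quad\text{if } n\geq 4.$$
   Context: The function $F$ is the case $d=2$ of the Fröberg function for $n$ forms of constant degree $a$ in $d+1$ variables, $F(m)=\sum_{s=0}^n(-1)^s\binom{n}{s}\binom{d+m-sa}{d}$. All binomial coefficients $\binom{N}{K}$ with integer $N$ (possibly negative) are set to zero unless $N\ge K\ge 0$. *)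

theory Defs
  imports Complex_Main
begin

(* The convention for negative upper arguments differs from that of gchoose:
   binom0 N K vanishes unless 0 \<le> K \<le> N. *)
definition binom0 :: "int \<Rightarrow> int \<Rightarrow> int" where
  "binom0 N K = (if 0 \<le> K \<and> K \<le> N then int (nat N choose nat K) else 0)"

(* The Froeberg function for n forms of constant degree a in d + 1 variables;
   the subtraction d + m - s * a takes place in the integers. *)
definition froeberg :: "nat \<Rightarrow> nat \<Rightarrow> nat \<Rightarrow> nat \<Rightarrow> int" where
  "froeberg d n a m =
     (\<Sum>s = 0..n. (- 1) ^ s * binom0 (int n) (int s)
                     * binom0 (int d + int m - int s * int a) (int d))"

definition froeberg_pos :: "nat \<Rightarrow> nat \<Rightarrow> nat \<Rightarrow> nat \<Rightarrow> int" where
  "froeberg_pos d n a m = max 0 (froeberg d n a m)"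

definition is_smallest_zero :: "(nat \<Rightarrow> int) \<Rightarrow> nat \<Rightarrow> bool" where
  "is_smallest_zero f m0 \<longleftrightarrow> f m0 = 0 \<and> (\<forall>m. f m = 0 \<longrightarrow> m0 \<le> m)"

end

theory Submission
  imports Defs
begin

text \<open>
  The summand with index \<open>s\<close> vanishes once \<open>s * a\<close> exceeds \<open>m\<close>, so for small \<open>m\<close> the alternating
  sum is an explicit quadratic polynomial. For \<open>m < a\<close> only the positive term \<open>s = 0\<close> is left, and
  for \<open>a \<le> m < 2 * a\<close> twice the value of the sum is
  \<open>(m + 2) * (m + 1) - n * (m - a + 2) * (m - a + 1)\<close>. Completing the square
  (\<open>two_term_quadratic_square\<close>) shows that the number \<open>r\<close> under the ceiling is the larger root of
  this polynomial. As the leading coefficient is negative and the value at \<open>a - 1\<close> is positive,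
  an \<open>x \<ge> a - 1\<close> satisfies \<open>x < r\<close> exactly if the polynomial is positive at \<open>x\<close>
  (\<open>two_term_quadratic_pos_iff\<close>).

  For \<open>n \<ge> 4\<close> the value at \<open>2 * a - 1\<close> is \<open>a * (4 * a + 2 - n * (a + 1)) < 0\<close>. Hence
  \<open>a - 1 < r < 2 * a - 1\<close>, the whole search takes place where the two-term formula is valid, and
  the function first fails to be positive at the ceiling of \<open>r\<close>.

  For \<open>n = 3\<close> the quadratic is still positive up to \<open>2 * a - 2\<close>, so the third term is needed. On
  \<open>2 * a - 2 \<le> m < 3 * a\<close> all three terms are polynomial, and because the third difference with
  step \<open>a\<close> of a quadratic polynomial is zero, they add up to the omitted fourth term with its sign
  reversed, which gives \<open>(3 * a - 2 - m) * (3 * a - 1 - m) / 2\<close>. Its first zero is \<open>3 * a - 2\<close>.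
\<close>

section \<open>The Froeberg function as a quadratic polynomial\<close>

text \<open>
  The polynomial \<open>N * (N - 1)\<close> also vanishes at \<open>0\<close> and \<open>1\<close>, so it describes the truncated binomial
  coefficient two steps beyond the range \<open>N \<ge> 2\<close>. This overlap makes the pieces of
  the Froeberg function agree on two consecutive arguments.
\<close>

lemma two_times_binom0_two:
  assumes "0 \<le> N"
  shows "2 * binom0 N 2 = N * (N - 1)"
proof -
  obtain k where k: "N = int k"
    using assms nonneg_int_cases by blast
  have "2 * (k choose 2) = k * (k - 1)"
    unfolding choose_two by (cases k) simp_all
  then have "2 * int (k choose 2) = int k * int (k - 1)"
    by (metis of_nat_mult of_nat_numeral)
  also have "\<dots> = int k * (int k - 1)"
    by (cases k) simp_all
  finally have "2 * int (k choose 2) = int k * (int k - 1)" .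
  moreover have "k choose 2 = 0" if "k < 2"
    using that by (rule binomial_eq_0)
  ultimately show ?thesis
    by (auto simp: binom0_def k)
qed

lemma binom0_of_nat: "binom0 (int n) (int k) = int (n choose k)"
  by (simp add: binom0_def)

lemma binom0_eq_0: "N < K \<Longrightarrow> binom0 N K = 0"
  by (simp add: binom0_def)

text \<open>
  The bound \<open>k\<close> may exceed \<open>n + 1\<close>: the factor \<open>n choose s\<close> then removes the extra summands.
\<close>

lemma froeberg_truncate:
  assumes "m < k * a"
  shows "froeberg d n a m =
    (\<Sum>s<k. (- 1) ^ s * int (n choose s) * binom0 (int d + int m - int s * int a) (int d))"
    (is "_ = sum ?f _")
proof -
  have high: "?f s = 0" if "s \<ge> k" for s
  proof -
    have "m < s * a"
      using assms mult_le_mono1[OF that, of a] by linarith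
    then have "int m < int s * int a"
      by (metis of_nat_less_iff of_nat_mult)
    then show ?thesis
      by (simp add: binom0_eq_0)
  qed
  have "sum ?f {0..n} = sum ?f ({0..n} \<union> {..<k})"
    by (rule sum.mono_neutral_left) auto
  also have "\<dots> = sum ?f {..<k}"
    by (rule sum.mono_neutral_right) (use high in auto)
  finally show ?thesis
    by (simp add: froeberg_def binom0_of_nat)
qed

definition two_term_quadratic :: "'a::comm_ring_1 \<Rightarrow> 'a \<Rightarrow> 'a \<Rightarrow> 'a" where
  "two_term_quadratic n a x = (x + 2) * (x + 1) - n * ((x - a + 2) * (x - a + 1))"

lemma froeberg_two_terms:
  assumes "a \<le> m + 2" "m < 2 * a"
  shows "2 * froeberg 2 n a m = two_term_quadratic (int n) (int a) (int m)"
proof -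
  have "froeberg 2 n a m = binom0 (int m + 2) 2 - int n * binom0 (int m - int a + 2) 2"
    using froeberg_truncate[OF assms(2), of 2 n]
    by (simp add: lessThan_nat_numeral lessThan_Suc algebra_simps)
  moreover have "2 * binom0 (int m + 2) 2 = (int m + 2) * (int m + 1)"
    using two_times_binom0_two[of "int m + 2"] by simp
  moreover have "2 * binom0 (int m - int a + 2) 2 = (int m - int a + 2) * (int m - int a + 1)"
    using two_times_binom0_two[of "int m - int a + 2"] assms by simp
  ultimately show ?thesis
    unfolding two_term_quadratic_def by algebra
qed

lemma froeberg_pos_if_less:
  assumes "m < a"
  shows "0 < froeberg 2 n a m"
proof -
  have "froeberg 2 n a m = binom0 (2 + int m) 2"
    using froeberg_truncate[of m 1 a 2 n] assms by (simp add: binom0_def)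
  then show ?thesis
    by (simp add: binom0_def)
qed

text \<open>
  The value is that of the polynomial binomial coefficient belonging to \<open>s = 3\<close>. It replaces
  the other three terms because the third difference of a quadratic is zero.
\<close>

lemma froeberg_three_forms:
  assumes "2 * a \<le> m + 2" "m < 3 * a"
  shows "2 * froeberg 2 3 a m = (3 * int a - 2 - int m) * (3 * int a - 1 - int m)"
proof -
  have "froeberg 2 3 a m = binom0 (int m + 2) 2 - 3 * binom0 (int m - int a + 2) 2
      + 3 * binom0 (int m - 2 * int a + 2) 2"
    using froeberg_truncate[OF assms(2), of 2 3]
    by (simp add: lessThan_nat_numeral lessThan_Suc choose_two algebra_simps)
  moreover have "2 * binom0 (int m + 2) 2 = (int m + 2) * (int m + 1)"
    using two_times_binom0_two[of "int m + 2"] by simp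
  moreover have "2 * binom0 (int m - int a + 2) 2 = (int m - int a + 2) * (int m - int a + 1)"
    using two_times_binom0_two[of "int m - int a + 2"] assms by simp
  moreover have "2 * binom0 (int m - 2 * int a + 2) 2
      = (int m - 2 * int a + 2) * (int m - 2 * int a + 1)"
    using two_times_binom0_two[of "int m - 2 * int a + 2"] assms by simp
  ultimately show ?thesis
    by algebra
qed

section \<open>The larger root of the quadratic\<close>

definition larger_root :: "real \<Rightarrow> real \<Rightarrow> real" where
  "larger_root n a =
     1 / (2 * (n - 1)) * (3 - 3 * n + 2 * a * n + sqrt (1 - 2 * n + n\<^sup>2 + 4 * a\<^sup>2 * n))"

lemma two_term_quadratic_square:
  fixes n a x :: "'a::comm_ring_1"
  shows "4 * (n - 1) * two_term_quadratic n a x =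
    (1 - 2 * n + n\<^sup>2 + 4 * a\<^sup>2 * n) - (2 * (n - 1) * x - (3 - 3 * n + 2 * a * n))\<^sup>2"
  by (simp add: two_term_quadratic_def power2_eq_square algebra_simps)

text \<open>
  By completing the square, positivity says that \<open>x\<close> lies strictly between the two roots. The point
  \<open>a - 1\<close> does, so any \<open>x\<close> to its right lies above the smaller root and only the larger one matters.
\<close>

lemma two_term_quadratic_pos_iff:
  fixes n a x :: real
  assumes "1 < n" "0 < a" "a - 1 \<le> x"
  shows "0 < two_term_quadratic n a x \<longleftrightarrow> x < larger_root n a"
proof -
  define D where "D = 1 - 2 * n + n\<^sup>2 + 4 * a\<^sup>2 * n"
  define y where "y x = 2 * (n - 1) * x - (3 - 3 * n + 2 * a * n)" for x
  have "0 \<le> (n - 1)\<^sup>2 + 4 * a\<^sup>2 * n"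
    using assms by simp
  then have D: "0 \<le> D"
    by (simp add: D_def power2_eq_square algebra_simps)
  have pos_iff: "0 < two_term_quadratic n a z \<longleftrightarrow> \<bar>y z\<bar> < sqrt D" for z
  proof -
    have "0 < two_term_quadratic n a z \<longleftrightarrow> 0 < 4 * (n - 1) * two_term_quadratic n a z"
      using assms(1) by (simp add: zero_less_mult_iff)
    also have "\<dots> \<longleftrightarrow> (y z)\<^sup>2 < D"
      unfolding two_term_quadratic_square D_def y_def by simp
    also have "\<dots> \<longleftrightarrow> sqrt ((y z)\<^sup>2) < sqrt D"
      by (simp only: real_sqrt_less_iff)
    finally show ?thesis
      by simp
  qed
  have "two_term_quadratic n a (a - 1) = (a + 1) * a"
    by (simp add: two_term_quadratic_def)
  then have "- sqrt D < y (a - 1)"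
    using pos_iff[of "a - 1"] assms(2) by simp
  also have "y (a - 1) \<le> y x"
    using assms by (simp add: y_def)
  finally have "0 < two_term_quadratic n a x \<longleftrightarrow> y x < sqrt D"
    using pos_iff[of x] by auto
  also have "\<dots> \<longleftrightarrow> x < larger_root n a"
    using assms(1) by (simp add: y_def D_def larger_root_def field_simps)
  finally show ?thesis .
qed

lemma larger_root_greater:
  assumes "1 < n" "0 < a"
  shows "a - 1 < larger_root n a"
proof -
  have "two_term_quadratic n a (a - 1) = (a + 1) * a"
    by (simp add: two_term_quadratic_def)
  then show ?thesis
    using two_term_quadratic_pos_iff[of n a "a - 1"] assms by simp
qed

lemma larger_root_le:
  assumes "4 \<le> n" "0 < a"
  shows "larger_root n a \<le> 2 * a - 1"
proof -
  have "two_term_quadratic n a (2 * a - 1) = a * (4 * a + 2 - n * (a + 1))"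
    unfolding two_term_quadratic_def by algebra
  moreover have "4 * (a + 1) \<le> n * (a + 1)"
    using assms by (intro mult_right_mono) auto
  ultimately have "\<not> 0 < two_term_quadratic n a (2 * a - 1)"
    using assms by (simp add: zero_less_mult_iff)
  then show ?thesis
    using two_term_quadratic_pos_iff[of n a "2 * a - 1"] assms by simp
qed

section \<open>The smallest zero\<close>

lemma is_smallest_zero_froeberg_posI:
  assumes "froeberg d n a m0 \<le> 0" "\<And>m. m < m0 \<Longrightarrow> 0 < froeberg d n a m"
  shows "is_smallest_zero (froeberg_pos d n a) m0"
  using assms by (force simp: is_smallest_zero_def froeberg_pos_def not_less[symmetric])

lemma smallest_zero_three_forms:
  assumes "1 \<le> a"
  shows "is_smallest_zero (froeberg_pos 2 3 a) (3 * a - 2)"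
proof (rule is_smallest_zero_froeberg_posI)
  show "froeberg 2 3 a (3 * a - 2) \<le> 0"
    using froeberg_three_forms[of a "3 * a - 2"] assms by simp
next
  fix m
  assume m: "m < 3 * a - 2"
  consider "m < a" | "a \<le> m" "m + 2 < 2 * a" | "2 * a \<le> m + 2"
    by linarith
  then show "0 < froeberg 2 3 a m"
  proof cases
    case 1
    then show ?thesis
      by (rule froeberg_pos_if_less)
  next
    case 2
    \<comment> \<open>With \<open>t = m - a + 1\<close> and \<open>a = t + 1 + u\<close> the quadratic is a polynomial in \<open>t\<close> and \<open>u\<close>
      with nonnegative coefficients.\<close>
    define t u where "t = int m - int a + 1" and "u = 2 * int a - 2 - int m"
    have nonneg: "0 \<le> t" "0 \<le> u" and eqs: "int a = t + 1 + u" "int m = 2 * t + u"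
      using 2 by (auto simp: t_def u_def)
    have "2 * froeberg 2 3 a m = two_term_quadratic 3 (int a) (int m)"
      using froeberg_two_terms[of a m 3] 2 by simp
    also have "\<dots> = (t + 1) * (t + 2) + u * (4 * t + 3 + u)"
      unfolding two_term_quadratic_def eqs by algebra
    also have "\<dots> > 0"
      using nonneg by (simp add: add_pos_nonneg)
    finally show ?thesis
      by simp
  next
    case 3
    then have "2 * froeberg 2 3 a m = (3 * int a - 2 - int m) * (3 * int a - 1 - int m)"
      using froeberg_three_forms[of a m] m by simp
    also have "\<dots> > 0"
      using m by (intro mult_pos_pos) auto
    finally show ?thesis
      by simp
  qed
qed

lemma smallest_zero_four_or_more_forms:
  assumes "4 \<le> n" "1 \<le> a"
  shows "is_smallest_zero (froeberg_pos 2 n a) (nat \<lceil>larger_root (real n) (real a)\<rceil>)"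
proof (rule is_smallest_zero_froeberg_posI)
  let ?r = "larger_root (real n) (real a)"
  let ?m0 = "nat \<lceil>?r\<rceil>"
  have r: "real a - 1 < ?r" "?r \<le> 2 * real a - 1"
    using assms by (auto intro: larger_root_greater larger_root_le)
  have pos_iff: "0 < froeberg 2 n a m \<longleftrightarrow> real m < ?r" if "a \<le> m" "m < 2 * a" for m
  proof -
    have "2 * froeberg 2 n a m = two_term_quadratic (int n) (int a) (int m)"
      using that by (intro froeberg_two_terms) auto
    then have "real_of_int (2 * froeberg 2 n a m) = two_term_quadratic (real n) (real a) (real m)"
      by (simp add: two_term_quadratic_def)
    then have "0 < froeberg 2 n a m \<longleftrightarrow> 0 < two_term_quadratic (real n) (real a) (real m)"
      by linarith
    then show ?thesis
      using two_term_quadratic_pos_iff[of "real n" "real a" "real m"] assms that by simp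
  qed
  have m0: "a \<le> ?m0" "?m0 < 2 * a" "?r \<le> real ?m0"
    using r assms(2) by linarith+
  then show "froeberg 2 n a ?m0 \<le> 0"
    using pos_iff[of ?m0] by linarith
  fix m
  assume m: "m < ?m0"
  show "0 < froeberg 2 n a m"
  proof (cases "m < a")
    case True
    then show ?thesis
      by (rule froeberg_pos_if_less)
  next
    case False
    have "real m < ?r"
      using m by linarith
    then show ?thesis
      using pos_iff[of m] False m m0(2) by simp
  qed
qed

theorem lemma4p8:
  fixes n a :: nat
  assumes "n \<ge> 3" and "a \<ge> 1"
  shows "\<exists>m0. is_smallest_zero (froeberg_pos 2 n a) m0
           \<and> (n = 3 \<longrightarrow> int m0 = 3 * int a - 2)
           \<and> (n \<ge> 4 \<longrightarrow> int m0 =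
                \<lceil>1 / (2 * (real n - 1))
                  * (3 - 3 * real n + 2 * real a * real n
                     + sqrt (1 - 2 * real n + (real n)\<^sup>2 + 4 * (real a)\<^sup>2 * real n))\<rceil>)"
proof (cases "n = 3")
  case True
  then show ?thesis
    using smallest_zero_three_forms[OF assms(2)] assms(2)
    by (intro exI[of _ "3 * a - 2"]) simp
next
  case False
  then have n: "4 \<le> n"
    using assms(1) by simp
  have "0 \<le> \<lceil>larger_root (real n) (real a)\<rceil>"
    using larger_root_greater[of "real n" "real a"] n assms(2) by simp
  then show ?thesis
    using smallest_zero_four_or_more_forms[OF n assms(2)] False
    by (intro exI[of _ "nat \<lceil>larger_root (real n) (real a)\<rceil>"]) (simp add: larger_root_def)
qed

end
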